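(* Consider an ergodic time-reversible Markov chain on a finite state space $\Omega$ with transition probabilities $P$ and stationary distribution $\pi$, and let $\Omega=\Omega_0\cup\cdots\cup\Omega_{m-1}$ be a partition of $\Omega$ into $m$ disjoint blocks, with induced projection chain $(\overline P,\bar\pi)$ on $[m]=\{0,\dots,m-1\}$ and restriction chains $(P_i,\pi_i)$ on $\Omega_i$, $i\in[m]$. Suppose the projection chain satisfies a Poincaré inequality with constant $\bar\lambda>0$, and that every restriction chain ($i\in[m]$) satisfies a Poincaré inequality with the uniform constant $\lambda_{\min}>0$. Let $$\gamma := \max_{i \in [m]} \max_{x \in \Omega_i} \sum_{y \in \Omega \setminus \Omega_i} P(x, y).$$ Then the original Markov chain satisfies a Poincaré inequality with constant $$\lambda := \min\left\{\frac{\bar{\lambda}}{3}, \frac{\bar{\lambda}\lambda_{\min}}{3\gamma + \bar{\lambda}}\right\},$$ i.e. $\mathcal{E}_\pi(f,f)\ge \lambda\,\mathrm{Var}_\pi f$ for all $f:\Omega\to\mathbb{R}$.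
   Context: Time-reversible means $\pi(x)P(x,y)=\pi(y)P(y,x)$ for all $x,y\in\Omega$. Blocks of a partition are nonempty. Projection chain: the Markov chain on $[m]$ with $\bar\pi(i)=\sum_{x\in\Omega_i}\pi(x)$ and $\overline P(i,j)=\bar\pi(i)^{-1}\sum_{x\in\Omega_i,\,y\in\Omega_j}\pi(x)P(x,y)$; it is time-reversible with stationary distribution $\bar\pi$. Restriction chain on $\Omega_i$: $P_i(x,y)=P(x,y)$ for $x\neq y$ in $\Omega_i$ and $P_i(x,x)=1-\sum_{z\in\Omega_i\setminus\{x\}}P(x,z)$; it is time-reversible with stationary distribution $\pi_i(x)=\pi(x)/\bar\pi(i)$. For a chain with transition probabilities $Q$ and stationary distribution $\mu$ on a finite set $S$, and $f:S\to\mathbb{R}$: $\mathrm{E}_\mu f=\sum_{x}\mu(x)f(x)$, $\mathrm{Var}_\mu f=\sum_x\mu(x)(f(x)-\mathrm{E}_\mu f)^2$, and the Dirichlet form is $\mathcal{E}_\mu(f,f)=\frac12\sum_{x,y\in S}\mu(x)Q(x,y)(f(x)-f(y))^2$ (so $\mathcal{E}_\pi$, $\mathcal{E}_{\bar\pi}$, $\mathcal{E}_{\pi_i}$ use $P$, $\overline P$, $P_i$ respectively). The chain satisfies a Poincaré inequality with constant $\kappa$ if $\mathcal{E}_\mu(f,f)\ge\kappa\,\mathrm{Var}_\mu f$ for all $f:S\to\mathbb{R}$. *)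

theory Defs
  imports Complex_Main "HOL-Library.Disjoint_Sets"
begin

text \<open>
  A chain on a finite set S is given by real-valued transition probabilities Q and a weight
  function \<mu>, both total functions of which only the values on S are used.
\<close>

definition stochastic_on :: "'a set \<Rightarrow> ('a \<Rightarrow> 'a \<Rightarrow> real) \<Rightarrow> bool" where
  "stochastic_on S Q \<longleftrightarrow>
     (\<forall>x\<in>S. (\<forall>y\<in>S. 0 \<le> Q x y) \<and> (\<Sum>y\<in>S. Q x y) = 1)"

definition distribution_on :: "'a set \<Rightarrow> ('a \<Rightarrow> real) \<Rightarrow> bool" where
  "distribution_on S \<mu> \<longleftrightarrow> (\<forall>x\<in>S. 0 \<le> \<mu> x) \<and> (\<Sum>x\<in>S. \<mu> x) = 1"

definition stationary_on :: "'a set \<Rightarrow> ('a \<Rightarrow> 'a \<Rightarrow> real) \<Rightarrow> ('a \<Rightarrow> real) \<Rightarrow> bool" where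
  "stationary_on S Q \<mu> \<longleftrightarrow>
     distribution_on S \<mu> \<and> (\<forall>y\<in>S. (\<Sum>x\<in>S. \<mu> x * Q x y) = \<mu> y)"

definition time_reversible_on :: "'a set \<Rightarrow> ('a \<Rightarrow> 'a \<Rightarrow> real) \<Rightarrow> ('a \<Rightarrow> real) \<Rightarrow> bool" where
  "time_reversible_on S Q \<mu> \<longleftrightarrow> (\<forall>x\<in>S. \<forall>y\<in>S. \<mu> x * Q x y = \<mu> y * Q y x)"

primrec step_prob :: "'a set \<Rightarrow> ('a \<Rightarrow> 'a \<Rightarrow> real) \<Rightarrow> nat \<Rightarrow> 'a \<Rightarrow> 'a \<Rightarrow> real" where
  "step_prob S Q 0 x y = (if x = y then 1 else 0)"
| "step_prob S Q (Suc n) x y = (\<Sum>z\<in>S. step_prob S Q n x z * Q z y)"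

definition irreducible_on :: "'a set \<Rightarrow> ('a \<Rightarrow> 'a \<Rightarrow> real) \<Rightarrow> bool" where
  "irreducible_on S Q \<longleftrightarrow> (\<forall>x\<in>S. \<forall>y\<in>S. \<exists>n. 0 < step_prob S Q n x y)"

definition aperiodic_on :: "'a set \<Rightarrow> ('a \<Rightarrow> 'a \<Rightarrow> real) \<Rightarrow> bool" where
  "aperiodic_on S Q \<longleftrightarrow> (\<forall>x\<in>S. Gcd {n. 0 < n \<and> 0 < step_prob S Q n x x} = 1)"

definition ergodic_on :: "'a set \<Rightarrow> ('a \<Rightarrow> 'a \<Rightarrow> real) \<Rightarrow> bool" where
  "ergodic_on S Q \<longleftrightarrow> irreducible_on S Q \<and> aperiodic_on S Q"

definition mean_on :: "'a set \<Rightarrow> ('a \<Rightarrow> real) \<Rightarrow> ('a \<Rightarrow> real) \<Rightarrow> real" where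
  "mean_on S \<mu> f = (\<Sum>x\<in>S. \<mu> x * f x)"

definition var_on :: "'a set \<Rightarrow> ('a \<Rightarrow> real) \<Rightarrow> ('a \<Rightarrow> real) \<Rightarrow> real" where
  "var_on S \<mu> f = (\<Sum>x\<in>S. \<mu> x * (f x - mean_on S \<mu> f)\<^sup>2)"

definition dirichlet_on ::
    "'a set \<Rightarrow> ('a \<Rightarrow> 'a \<Rightarrow> real) \<Rightarrow> ('a \<Rightarrow> real) \<Rightarrow> ('a \<Rightarrow> real) \<Rightarrow> real" where
  "dirichlet_on S Q \<mu> f = 1 / 2 * (\<Sum>x\<in>S. \<Sum>y\<in>S. \<mu> x * Q x y * (f x - f y)\<^sup>2)"

definition poincare_on ::
    "'a set \<Rightarrow> ('a \<Rightarrow> 'a \<Rightarrow> real) \<Rightarrow> ('a \<Rightarrow> real) \<Rightarrow> real \<Rightarrow> bool" where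
  "poincare_on S Q \<mu> \<kappa> \<longleftrightarrow> (\<forall>f. \<kappa> * var_on S \<mu> f \<le> dirichlet_on S Q \<mu> f)"

definition block_partition :: "'a set \<Rightarrow> nat \<Rightarrow> (nat \<Rightarrow> 'a set) \<Rightarrow> bool" where
  "block_partition \<Omega> m B \<longleftrightarrow>
     (\<forall>i<m. B i \<noteq> {}) \<and> disjoint_family_on B {..<m} \<and> (\<Union>i<m. B i) = \<Omega>"

definition proj_dist :: "(nat \<Rightarrow> 'a set) \<Rightarrow> ('a \<Rightarrow> real) \<Rightarrow> nat \<Rightarrow> real" where
  "proj_dist B \<pi> i = (\<Sum>x\<in>B i. \<pi> x)"

definition proj_trans ::
    "(nat \<Rightarrow> 'a set) \<Rightarrow> ('a \<Rightarrow> 'a \<Rightarrow> real) \<Rightarrow> ('a \<Rightarrow> real) \<Rightarrow> nat \<Rightarrow> nat \<Rightarrow> real" where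
  "proj_trans B P \<pi> i j = inverse (proj_dist B \<pi> i) * (\<Sum>x\<in>B i. \<Sum>y\<in>B j. \<pi> x * P x y)"

definition restr_dist :: "(nat \<Rightarrow> 'a set) \<Rightarrow> ('a \<Rightarrow> real) \<Rightarrow> nat \<Rightarrow> 'a \<Rightarrow> real" where
  "restr_dist B \<pi> i x = \<pi> x / proj_dist B \<pi> i"

definition restr_trans ::
    "(nat \<Rightarrow> 'a set) \<Rightarrow> ('a \<Rightarrow> 'a \<Rightarrow> real) \<Rightarrow> nat \<Rightarrow> 'a \<Rightarrow> 'a \<Rightarrow> real" where
  "restr_trans B P i x y = (if x = y then 1 - (\<Sum>z\<in>B i - {x}. P x z) else P x y)"

definition max_escape ::
    "'a set \<Rightarrow> nat \<Rightarrow> (nat \<Rightarrow> 'a set) \<Rightarrow> ('a \<Rightarrow> 'a \<Rightarrow> real) \<Rightarrow> real" where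
  "max_escape \<Omega> m B P = (MAX i\<in>{..<m}. MAX x\<in>B i. \<Sum>y\<in>\<Omega> - B i. P x y)"

end

theory Submission
  imports Defs
begin

text \<open>
  Replace \<open>f\<close> by its block average \<open>g\<close>. The variance of \<open>f\<close> is the sum \<open>W\<close> of the weighted variances
  inside the blocks plus the variance of \<open>g\<close>, and the Dirichlet form of \<open>f\<close> is the sum \<open>A\<close> of the
  weighted Dirichlet forms of the restrictions plus the contribution \<open>C\<close> of transitions between
  different blocks. The Poincare inequality of the restrictions gives \<open>lam_min * W \<le> A\<close>. For
  \<open>x\<close>, \<open>y\<close> in different blocks, \<open>(g x - g y)\<^sup>2\<close> is at most
  \<open>3 * ((g x - f x)\<^sup>2 + (f x - f y)\<^sup>2 + (f y - g y)\<^sup>2)\<close>; averaging, and using reversibility for the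
  last summand, the Poincare inequality of the projection yields
  \<open>lam_bar * Var g \<le> 3 * C + 3 * \<gamma> * W\<close>. The two bounds combine to the claim.
\<close>

text \<open>This is Cauchy-Schwarz against the vector (1, 1, 1). It is the source of the factor 3 in
  the final constant.\<close>

lemma square_sum3_le: "(a + b + c)\<^sup>2 \<le> 3 * (a\<^sup>2 + b\<^sup>2 + c\<^sup>2)" for a b c :: real
proof -
  have "3 * (a\<^sup>2 + b\<^sup>2 + c\<^sup>2) - (a + b + c)\<^sup>2 = (a - b)\<^sup>2 + (b - c)\<^sup>2 + (a - c)\<^sup>2"
    by (simp add: power2_eq_square algebra_simps)
  then show ?thesis by (smt (verit) zero_le_power2)
qed

section \<open>Blocks of the partition and sums over them\<close>

locale partitioned_chain =
  fixes \<Omega> :: "'a set" and P :: "'a \<Rightarrow> 'a \<Rightarrow> real" and \<pi> :: "'a \<Rightarrow> real"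
    and m :: nat and B :: "nat \<Rightarrow> 'a set"
  assumes finite_space: "finite \<Omega>"
    and trans_nonneg: "\<And>x y. x \<in> \<Omega> \<Longrightarrow> y \<in> \<Omega> \<Longrightarrow> 0 \<le> P x y"
    and dist_nonneg: "\<And>x. x \<in> \<Omega> \<Longrightarrow> 0 \<le> \<pi> x"
    and reversible: "time_reversible_on \<Omega> P \<pi>"
    and partition: "block_partition \<Omega> m B"
begin

definition block_of :: "'a \<Rightarrow> nat" where
  "block_of x = (THE i. i < m \<and> x \<in> B i)"

definition block_mean :: "('a \<Rightarrow> real) \<Rightarrow> nat \<Rightarrow> real" where
  "block_mean f i = mean_on (B i) (restr_dist B \<pi> i) f"

text \<open>The different-block condition is a 0-1 factor rather than a restricted index set, so
  both sums run over all of \<Omega> and can be exchanged freely.\<close>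

definition cross_form :: "('a \<Rightarrow> real) \<Rightarrow> real" where
  "cross_form f = 1 / 2 * (\<Sum>x\<in>\<Omega>. \<Sum>y\<in>\<Omega>.
     of_bool (block_of x \<noteq> block_of y) * (\<pi> x * P x y * (f x - f y)\<^sup>2))"

lemma block_subset: "i < m \<Longrightarrow> B i \<subseteq> \<Omega>"
  using partition unfolding block_partition_def by blast

lemma finite_block: "i < m \<Longrightarrow> finite (B i)"
  using block_subset finite_space finite_subset by blast

lemma block_of_eq: "i < m \<Longrightarrow> x \<in> B i \<Longrightarrow> block_of x = i"
  using partition unfolding block_of_def block_partition_def disjoint_family_on_def
  by (intro the_equality) auto

lemma block_of_mem:
  assumes "x \<in> \<Omega>"
  shows "block_of x < m" "x \<in> B (block_of x)"
proof -
  obtain i where "i < m" "x \<in> B i"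
    using assms partition unfolding block_partition_def by blast
  then show "block_of x < m" "x \<in> B (block_of x)" by (simp_all add: block_of_eq)
qed

lemma sum_blocks: "(\<Sum>x\<in>\<Omega>. h x) = (\<Sum>i<m. \<Sum>x\<in>B i. h x)" for h :: "'a \<Rightarrow> real"
proof -
  have "\<Omega> = (\<Union>i<m. B i)" using partition by (simp add: block_partition_def)
  moreover have "(\<Sum>x\<in>(\<Union>i<m. B i). h x) = (\<Sum>i<m. \<Sum>x\<in>B i. h x)"
    using partition finite_block unfolding block_partition_def disjoint_family_on_def
    by (intro sum.UNION_disjoint) auto
  ultimately show ?thesis by simp
qed

lemma sum_same_block:
  fixes h :: "'a \<Rightarrow> real"
  assumes "i < m"
  shows "(\<Sum>y\<in>\<Omega>. of_bool (block_of y = i) * h y) = (\<Sum>y\<in>B i. h y)"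
proof -
  have "(\<Sum>y\<in>\<Omega>. of_bool (block_of y = i) * h y) = (\<Sum>y\<in>B i. of_bool (block_of y = i) * h y)"
    using finite_space block_subset[OF assms] block_of_mem
    by (intro sum.mono_neutral_right) auto
  also have "\<dots> = (\<Sum>y\<in>B i. h y)"
    using block_of_eq[OF assms] by (intro sum.cong) auto
  finally show ?thesis .
qed

section \<open>The projection chain seen on the original state space\<close>

lemma proj_dist_nonneg: "i < m \<Longrightarrow> 0 \<le> proj_dist B \<pi> i"
  using block_subset dist_nonneg unfolding proj_dist_def by (intro sum_nonneg) blast

text \<open>Blocks of weight zero, where \<^const>\<open>restr_dist\<close> and \<^const>\<open>proj_trans\<close> divide by zero, are
  covered here and below because \<open>\<pi>\<close> then vanishes on the block.\<close>

lemma dist_eq_0: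
  assumes "i < m" "x \<in> B i" "proj_dist B \<pi> i = 0"
  shows "\<pi> x = 0"
  using assms block_subset dist_nonneg finite_block
    sum_nonneg_eq_0_iff[of "B i" \<pi>] unfolding proj_dist_def by blast

lemma proj_dist_restr_dist:
  assumes "i < m" "x \<in> B i"
  shows "proj_dist B \<pi> i * restr_dist B \<pi> i x = \<pi> x"
  using dist_eq_0[OF assms] by (auto simp: restr_dist_def)

lemma proj_dist_proj_trans:
  assumes "i < m"
  shows "proj_dist B \<pi> i * proj_trans B P \<pi> i j = (\<Sum>x\<in>B i. \<Sum>y\<in>B j. \<pi> x * P x y)"
  using dist_eq_0[OF assms] by (cases "proj_dist B \<pi> i = 0") (auto simp: proj_trans_def)

lemma proj_dist_block_mean:
  assumes "i < m"
  shows "proj_dist B \<pi> i * block_mean f i = (\<Sum>x\<in>B i. \<pi> x * f x)"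
  unfolding block_mean_def mean_on_def sum_distrib_left
  by (intro sum.cong) (auto simp: proj_dist_restr_dist[OF assms] mult.assoc[symmetric])

text \<open>\<open>proj_dist\<close> is the image of \<pi> under \<open>block_of\<close>. Hence a
  function of the block index can be treated as a block-constant function on \<Omega>, which puts
  both chains on one space.\<close>

lemma mean_proj: "mean_on {..<m} (proj_dist B \<pi>) c = mean_on \<Omega> \<pi> (\<lambda>x. c (block_of x))"
  unfolding mean_on_def sum_blocks
  by (intro sum.cong) (auto simp: proj_dist_def sum_distrib_right block_of_eq)

lemma var_proj: "var_on {..<m} (proj_dist B \<pi>) c = var_on \<Omega> \<pi> (\<lambda>x. c (block_of x))"
  \<comment> \<open>A variance is itself a mean, namely of the squared deviation, so the transfer is
    applied once to the deviation and once to its centre.\<close>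
  using mean_proj[of "\<lambda>i. (c i - mean_on {..<m} (proj_dist B \<pi>) c)\<^sup>2"] mean_proj[of c]
  unfolding var_on_def by (simp add: mean_on_def)

lemma dirichlet_proj:
  "dirichlet_on {..<m} (proj_trans B P \<pi>) (proj_dist B \<pi>) c
     = dirichlet_on \<Omega> P \<pi> (\<lambda>x. c (block_of x))"
proof -
  have "(\<Sum>x\<in>\<Omega>. \<Sum>y\<in>\<Omega>. \<pi> x * P x y * (c (block_of x) - c (block_of y))\<^sup>2)
      = (\<Sum>i<m. \<Sum>x\<in>B i. \<Sum>j<m. \<Sum>y\<in>B j. \<pi> x * P x y * (c i - c j)\<^sup>2)"
    unfolding sum_blocks by (intro sum.cong) (auto simp: block_of_eq)
  also have "\<dots> = (\<Sum>i<m. \<Sum>j<m. \<Sum>x\<in>B i. \<Sum>y\<in>B j. \<pi> x * P x y * (c i - c j)\<^sup>2)"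
    by (intro sum.cong refl sum.swap)
  also have "\<dots> = (\<Sum>i<m. \<Sum>j<m. proj_dist B \<pi> i * proj_trans B P \<pi> i j * (c i - c j)\<^sup>2)"
    by (intro sum.cong) (auto simp: proj_dist_proj_trans sum_distrib_right)
  finally show ?thesis unfolding dirichlet_on_def by simp
qed

section \<open>Decomposition of the variance and of the Dirichlet form\<close>

lemma mean_block_mean: "mean_on \<Omega> \<pi> (\<lambda>x. block_mean f (block_of x)) = mean_on \<Omega> \<pi> f"
  unfolding mean_proj[symmetric]
  by (simp add: mean_on_def sum_blocks proj_dist_block_mean)

lemma within_block_variance:
  "(\<Sum>x\<in>\<Omega>. \<pi> x * (f x - block_mean f (block_of x))\<^sup>2)
     = (\<Sum>i<m. proj_dist B \<pi> i * var_on (B i) (restr_dist B \<pi> i) f)"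
  unfolding sum_blocks var_on_def sum_distrib_left mult.assoc[symmetric]
  by (intro sum.cong)
    (auto simp: block_of_eq proj_dist_restr_dist block_mean_def)

text \<open>The law of total variance: the deviation from the block mean is orthogonal, with respect
  to \<pi>, to every block-constant function.\<close>

lemma var_decomposition:
  "var_on \<Omega> \<pi> f = (\<Sum>i<m. proj_dist B \<pi> i * var_on (B i) (restr_dist B \<pi> i) f)
     + var_on {..<m} (proj_dist B \<pi>) (block_mean f)"
proof -
  define g where "g x = block_mean f (block_of x)" for x
  define e where "e = mean_on \<Omega> \<pi> f"
  have e: "mean_on \<Omega> \<pi> g = e" unfolding g_def e_def by (rule mean_block_mean)
  \<comment> \<open>Orthogonality holds block by block: on \<open>B i\<close> the factor
    \<open>g x - e\<close> is constant, and the weighted deviations \<open>f x - g x\<close> sum to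
    zero.\<close>
  have "(\<Sum>x\<in>B i. \<pi> x * (f x - g x) * (g x - e)) = 0" if i: "i < m" for i
  proof -
    have "(\<Sum>x\<in>B i. \<pi> x * (f x - g x) * (g x - e))
        = (\<Sum>x\<in>B i. \<pi> x * (f x - block_mean f i) * (block_mean f i - e))"
      using i by (intro sum.cong) (auto simp: g_def block_of_eq)
    also have "\<dots> = ((\<Sum>x\<in>B i. \<pi> x * f x) - proj_dist B \<pi> i * block_mean f i) * (block_mean f i - e)"
      by (simp add: proj_dist_def sum_distrib_right sum_subtractf[symmetric] right_diff_distrib)
    finally show ?thesis by (simp add: proj_dist_block_mean[OF i])
  qed
  then have orth: "(\<Sum>x\<in>\<Omega>. \<pi> x * (f x - g x) * (g x - e)) = 0"
    by (simp add: sum_blocks)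
  have "var_on \<Omega> \<pi> f = (\<Sum>x\<in>\<Omega>. \<pi> x * (f x - g x)\<^sup>2 + \<pi> x * (g x - e)\<^sup>2
      + 2 * (\<pi> x * (f x - g x) * (g x - e)))"
    unfolding var_on_def e_def[symmetric]
    by (intro sum.cong) (auto simp: power2_eq_square algebra_simps)
  also have "\<dots> = (\<Sum>x\<in>\<Omega>. \<pi> x * (f x - g x)\<^sup>2) + (\<Sum>x\<in>\<Omega>. \<pi> x * (g x - e)\<^sup>2)"
    by (simp add: sum.distrib sum_distrib_left[symmetric] orth)
  finally show ?thesis
    using e unfolding var_proj within_block_variance[symmetric] g_def by (simp add: var_on_def)
qed

text \<open>The restriction chain differs from \<open>P\<close> only on the diagonal, where the
  factor \<open>(f x - f y)\<^sup>2\<close> vanishes. The block weight cancels the normalization of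
  \<open>restr_dist\<close>.\<close>

lemma dirichlet_restr:
  assumes "i < m"
  shows "proj_dist B \<pi> i * dirichlet_on (B i) (restr_trans B P i) (restr_dist B \<pi> i) f
    = 1 / 2 * (\<Sum>x\<in>B i. \<Sum>y\<in>B i. \<pi> x * P x y * (f x - f y)\<^sup>2)"
proof -
  have "proj_dist B \<pi> i * (restr_dist B \<pi> i x * restr_trans B P i x y * (f x - f y)\<^sup>2)
      = \<pi> x * P x y * (f x - f y)\<^sup>2" if "x \<in> B i" for x y
    using proj_dist_restr_dist[OF assms that] by (auto simp: restr_trans_def mult.assoc[symmetric])
  then have "proj_dist B \<pi> i * (\<Sum>x\<in>B i. \<Sum>y\<in>B i.
        restr_dist B \<pi> i x * restr_trans B P i x y * (f x - f y)\<^sup>2)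
      = (\<Sum>x\<in>B i. \<Sum>y\<in>B i. \<pi> x * P x y * (f x - f y)\<^sup>2)"
    unfolding sum_distrib_left by (intro sum.cong refl)
  then show ?thesis by (simp add: dirichlet_on_def)
qed

lemma dirichlet_decomposition:
  "dirichlet_on \<Omega> P \<pi> f
     = (\<Sum>i<m. proj_dist B \<pi> i * dirichlet_on (B i) (restr_trans B P i) (restr_dist B \<pi> i) f)
       + cross_form f"
proof -
  define w where "w x y = \<pi> x * P x y * (f x - f y)\<^sup>2" for x y
  have "(\<Sum>x\<in>\<Omega>. \<Sum>y\<in>\<Omega>. w x y)
      = (\<Sum>x\<in>\<Omega>. \<Sum>y\<in>\<Omega>. of_bool (block_of y = block_of x) * w x y
          + of_bool (block_of x \<noteq> block_of y) * w x y)"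
    by (intro sum.cong) auto
  also have "\<dots> = (\<Sum>x\<in>\<Omega>. \<Sum>y\<in>B (block_of x). w x y)
      + (\<Sum>x\<in>\<Omega>. \<Sum>y\<in>\<Omega>. of_bool (block_of x \<noteq> block_of y) * w x y)"
    by (simp add: sum.distrib sum_same_block block_of_mem)
  also have "(\<Sum>x\<in>\<Omega>. \<Sum>y\<in>B (block_of x). w x y) = (\<Sum>i<m. \<Sum>x\<in>B i. \<Sum>y\<in>B i. w x y)"
    unfolding sum_blocks by (intro sum.cong) (auto simp: block_of_eq)
  also have "(\<Sum>i<m. \<Sum>x\<in>B i. \<Sum>y\<in>B i. w x y) = 2 * (\<Sum>i<m. proj_dist B \<pi> i
        * dirichlet_on (B i) (restr_trans B P i) (restr_dist B \<pi> i) f)"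
    by (simp add: sum_distrib_left dirichlet_restr w_def)
  finally show ?thesis by (simp add: dirichlet_on_def cross_form_def w_def)
qed

section \<open>Flow between different blocks\<close>

lemma escape_le:
  assumes "x \<in> \<Omega>"
  shows "(\<Sum>y\<in>\<Omega>. of_bool (block_of x \<noteq> block_of y) * P x y) \<le> max_escape \<Omega> m B P"
proof -
  define i where "i = block_of x"
  have i: "i < m" "x \<in> B i" using block_of_mem[OF assms] by (simp_all add: i_def)
  have "(\<Sum>y\<in>\<Omega>. of_bool (block_of x \<noteq> block_of y) * P x y)
      = (\<Sum>y\<in>\<Omega> - B i. of_bool (block_of x \<noteq> block_of y) * P x y)"
    using finite_space i block_of_eq by (intro sum.mono_neutral_right) auto
  also have "\<dots> = (\<Sum>y\<in>\<Omega> - B i. P x y)"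
    using block_of_mem by (intro sum.cong) (auto simp: i_def)
  also have "\<dots> \<le> (MAX x\<in>B i. \<Sum>y\<in>\<Omega> - B i. P x y)"
    using i finite_block by (intro Max_ge) auto
  also have "\<dots> \<le> max_escape \<Omega> m B P"
    unfolding max_escape_def using i by (intro Max_ge) auto
  finally show ?thesis .
qed

text \<open>A point of \<Omega> is required because a maximum over no blocks would be
  unspecified.\<close>

lemma max_escape_nonneg:
  assumes "\<Omega> \<noteq> {}"
  shows "0 \<le> max_escape \<Omega> m B P"
proof -
  obtain x where x: "x \<in> \<Omega>" using assms by blast
  have "0 \<le> (\<Sum>y\<in>\<Omega>. of_bool (block_of x \<noteq> block_of y) * P x y)"
    using x trans_nonneg by (intro sum_nonneg) auto
  then show ?thesis using escape_le[OF x] by linarith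
qed

text \<open>For fixed \<open>x\<close> the factor \<open>\<pi> x * h x\<close> leaves the inner sum,
  and what remains is the probability of leaving the block of \<open>x\<close> in one step.\<close>

lemma cross_flow_le:
  fixes h :: "'a \<Rightarrow> real"
  assumes "\<And>x. x \<in> \<Omega> \<Longrightarrow> 0 \<le> h x"
  shows "(\<Sum>x\<in>\<Omega>. \<Sum>y\<in>\<Omega>. of_bool (block_of x \<noteq> block_of y) * (\<pi> x * P x y) * h x)
    \<le> max_escape \<Omega> m B P * (\<Sum>x\<in>\<Omega>. \<pi> x * h x)"
proof -
  have "(\<Sum>y\<in>\<Omega>. of_bool (block_of x \<noteq> block_of y) * (\<pi> x * P x y) * h x)
      \<le> max_escape \<Omega> m B P * (\<pi> x * h x)" if x: "x \<in> \<Omega>" for x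
  proof -
    have "(\<Sum>y\<in>\<Omega>. of_bool (block_of x \<noteq> block_of y) * (\<pi> x * P x y) * h x)
        = (\<Sum>y\<in>\<Omega>. of_bool (block_of x \<noteq> block_of y) * P x y) * (\<pi> x * h x)"
      unfolding sum_distrib_right by (intro sum.cong) (auto simp: algebra_simps)
    also have "\<dots> \<le> max_escape \<Omega> m B P * (\<pi> x * h x)"
      using escape_le[OF x] dist_nonneg[OF x] assms[OF x] by (intro mult_right_mono) auto
    finally show ?thesis .
  qed
  then show ?thesis unfolding sum_distrib_left by (intro sum_mono)
qed

text \<open>By reversibility the flow \<open>\<pi> x * P x y\<close> is symmetric, and so is the
  different-block condition; exchanging the two variables moves \<open>h\<close> to the other
  endpoint.\<close>

lemma cross_flow_swap:
  fixes h :: "'a \<Rightarrow> real"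
  shows "(\<Sum>x\<in>\<Omega>. \<Sum>y\<in>\<Omega>. of_bool (block_of x \<noteq> block_of y) * (\<pi> x * P x y) * h y)
    = (\<Sum>x\<in>\<Omega>. \<Sum>y\<in>\<Omega>. of_bool (block_of x \<noteq> block_of y) * (\<pi> x * P x y) * h x)"
  using reversible unfolding time_reversible_on_def
  by (subst sum.swap) (auto intro!: sum.cong)

lemma dirichlet_proj_le:
  "dirichlet_on {..<m} (proj_trans B P \<pi>) (proj_dist B \<pi>) (block_mean f)
     \<le> 3 * cross_form f
       + 3 * max_escape \<Omega> m B P * (\<Sum>i<m. proj_dist B \<pi> i * var_on (B i) (restr_dist B \<pi> i) f)"
proof -
  define g where "g x = block_mean f (block_of x)" for x
  define h where "h x = (f x - g x)\<^sup>2" for x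
  define q where "q x y = of_bool (block_of x \<noteq> block_of y) * (\<pi> x * P x y)" for x y
  \<comment> \<open>Pairs in one block contribute nothing on the left since \<open>g\<close> is
    block-constant, so the right-hand side may carry the cross flow \<open>q\<close> instead of the
    full flow.\<close>
  have step: "\<pi> x * P x y * (g x - g y)\<^sup>2
      \<le> 3 * (q x y * h x) + 3 * (q x y * (f x - f y)\<^sup>2) + 3 * (q x y * h y)"
    if "x \<in> \<Omega>" "y \<in> \<Omega>" for x y
  proof (cases "block_of x = block_of y")
    case True
    then show ?thesis by (simp add: q_def g_def)
  next
    case False
    have "(g x - g y)\<^sup>2 \<le> 3 * (h x + (f x - f y)\<^sup>2 + h y)"
      using square_sum3_le[of "g x - f x" "f x - f y" "f y - g y"]
      by (simp add: h_def power2_commute)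
    then have "\<pi> x * P x y * (g x - g y)\<^sup>2 \<le> \<pi> x * P x y * (3 * (h x + (f x - f y)\<^sup>2 + h y))"
      using dist_nonneg trans_nonneg that by (intro mult_left_mono) auto
    then show ?thesis using False by (simp add: q_def algebra_simps)
  qed
  have "2 * dirichlet_on {..<m} (proj_trans B P \<pi>) (proj_dist B \<pi>) (block_mean f)
      = (\<Sum>x\<in>\<Omega>. \<Sum>y\<in>\<Omega>. \<pi> x * P x y * (g x - g y)\<^sup>2)"
    unfolding dirichlet_proj by (simp add: dirichlet_on_def g_def)
  also have "\<dots> \<le> (\<Sum>x\<in>\<Omega>. \<Sum>y\<in>\<Omega>.
      3 * (q x y * h x) + 3 * (q x y * (f x - f y)\<^sup>2) + 3 * (q x y * h y))"
    by (intro sum_mono step)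
  also have "\<dots> = 3 * (\<Sum>x\<in>\<Omega>. \<Sum>y\<in>\<Omega>. q x y * h x) + 6 * cross_form f
      + 3 * (\<Sum>x\<in>\<Omega>. \<Sum>y\<in>\<Omega>. q x y * h y)"
    by (simp add: sum.distrib sum_distrib_left[symmetric] cross_form_def q_def mult.assoc)
  \<comment> \<open>The two endpoint sums coincide. The other 6 is 3 times the 2 that compensates
    the factor 1/2 in \<open>cross_form\<close>.\<close>
  also have "\<dots> = 6 * (\<Sum>x\<in>\<Omega>. \<Sum>y\<in>\<Omega>. q x y * h x) + 6 * cross_form f"
    unfolding q_def cross_flow_swap by simp
  also have "\<dots> \<le> 6 * (max_escape \<Omega> m B P * (\<Sum>x\<in>\<Omega>. \<pi> x * h x)) + 6 * cross_form f"
    using cross_flow_le[of h] unfolding q_def by (simp add: h_def)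
  finally show ?thesis
    unfolding h_def g_def within_block_variance by simp
qed

lemma cross_form_nonneg: "0 \<le> cross_form f"
  unfolding cross_form_def using dist_nonneg trans_nonneg
  by (intro mult_nonneg_nonneg sum_nonneg) auto

end

section \<open>Combination of the bounds into the constant\<close>

theorem theorem1:
  fixes \<Omega> :: "'a set"
    and P :: "'a \<Rightarrow> 'a \<Rightarrow> real"
    and \<pi> :: "'a \<Rightarrow> real"
    and m :: nat
    and B :: "nat \<Rightarrow> 'a set"
    and lam_bar lam_min \<gamma> :: real
  assumes "finite \<Omega>"
    and "stochastic_on \<Omega> P"
    and "stationary_on \<Omega> P \<pi>"
    and "ergodic_on \<Omega> P"
    and "time_reversible_on \<Omega> P \<pi>"
    and "block_partition \<Omega> m B"
    and "0 < lam_bar"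
    and "poincare_on {..<m} (proj_trans B P \<pi>) (proj_dist B \<pi>) lam_bar"
    and "0 < lam_min"
    and "\<forall>i<m. poincare_on (B i) (restr_trans B P i) (restr_dist B \<pi> i) lam_min"
    and "\<gamma> = max_escape \<Omega> m B P"
  shows "poincare_on \<Omega> P \<pi>
           (min (lam_bar / 3) (lam_bar * lam_min / (3 * \<gamma> + lam_bar)))"
proof -
  have "partitioned_chain \<Omega> P \<pi> m B"
    using assms(1-6) by unfold_locales
      (auto simp: stochastic_on_def stationary_on_def distribution_on_def)
  then interpret partitioned_chain \<Omega> P \<pi> m B .
  have "\<Omega> \<noteq> {}"
    using assms(3) by (auto simp: stationary_on_def distribution_on_def)
  then have \<gamma>: "0 \<le> \<gamma>" using max_escape_nonneg assms(11) by simp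
  show ?thesis
    unfolding poincare_on_def
  proof
    fix f :: "'a \<Rightarrow> real"
    let ?lam = "min (lam_bar / 3) (lam_bar * lam_min / (3 * \<gamma> + lam_bar))"
    define W where "W = (\<Sum>i<m. proj_dist B \<pi> i * var_on (B i) (restr_dist B \<pi> i) f)"
    define A where
      "A = (\<Sum>i<m. proj_dist B \<pi> i * dirichlet_on (B i) (restr_trans B P i) (restr_dist B \<pi> i) f)"
    define V where "V = var_on {..<m} (proj_dist B \<pi>) (block_mean f)"
    define C where "C = cross_form f"
    have "lam_min * W \<le> A"
      unfolding W_def A_def sum_distrib_left
    proof (rule sum_mono)
      fix i assume "i \<in> {..<m}"
      then have "proj_dist B \<pi> i * (lam_min * var_on (B i) (restr_dist B \<pi> i) f)
          \<le> proj_dist B \<pi> i * dirichlet_on (B i) (restr_trans B P i) (restr_dist B \<pi> i) f"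
        using assms(10) proj_dist_nonneg by (intro mult_left_mono) (auto simp: poincare_on_def)
      then show "lam_min * (proj_dist B \<pi> i * var_on (B i) (restr_dist B \<pi> i) f)
          \<le> proj_dist B \<pi> i * dirichlet_on (B i) (restr_trans B P i) (restr_dist B \<pi> i) f"
        by (simp add: algebra_simps)
    qed
    moreover have "0 \<le> W"
      unfolding W_def within_block_variance[symmetric] using dist_nonneg
      by (intro sum_nonneg) auto
    ultimately have "0 \<le> A"
      using assms(9) by (smt (verit) mult_nonneg_nonneg)
    have "0 \<le> C" unfolding C_def by (rule cross_form_nonneg)
    have V: "lam_bar * V \<le> 3 * C + 3 * \<gamma> * W"
      using assms(8) dirichlet_proj_le[of f] assms(11)
      unfolding poincare_on_def V_def W_def C_def by (smt (verit))
    have lam: "0 \<le> ?lam" using assms(7,9) \<gamma> by simp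
    \<comment> \<open>Adding \<open>lam_bar * W\<close> to the bound on \<open>V\<close> makes the
      coefficient of \<open>W\<close> equal to the denominator in the second entry of the
      minimum.\<close>
    have "lam_bar * (W + V) \<le> (3 * \<gamma> + lam_bar) * W + 3 * C"
      using V by (simp add: algebra_simps)
    then have "?lam * (lam_bar * (W + V)) \<le> ?lam * ((3 * \<gamma> + lam_bar) * W) + ?lam * (3 * C)"
      using mult_left_mono[OF _ lam] by (simp only: distrib_left[symmetric])
    \<comment> \<open>The second entry of the minimum controls the variance inside the blocks: its
      denominator cancels, and \<open>lam_min * W\<close> is bounded by \<open>A\<close>.\<close>
    also have "?lam * ((3 * \<gamma> + lam_bar) * W) \<le> lam_bar * A"
    proof -
      have "?lam * (3 * \<gamma> + lam_bar) \<le> lam_bar * lam_min / (3 * \<gamma> + lam_bar) * (3 * \<gamma> + lam_bar)"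
        using assms(7) \<gamma> by (intro mult_right_mono) auto
      also have "\<dots> = lam_bar * lam_min" using assms(7) \<gamma> by simp
      finally have "?lam * (3 * \<gamma> + lam_bar) * W \<le> lam_bar * lam_min * W"
        using \<open>0 \<le> W\<close> by (rule mult_right_mono)
      also have "\<dots> \<le> lam_bar * A"
        using \<open>lam_min * W \<le> A\<close> assms(7) by (simp add: mult.assoc)
      finally show ?thesis by (simp only: mult.assoc)
    qed
    \<comment> \<open>The first entry of the minimum absorbs the 3 in front of the cross
      term.\<close>
    also have "?lam * (3 * C) \<le> lam_bar * C"
    proof -
      have "?lam * (3 * C) \<le> lam_bar / 3 * (3 * C)"
        using \<open>0 \<le> C\<close> by (intro mult_right_mono min.cobounded1) simp
      then show ?thesis by simp
    qed
    \<comment> \<open>Both estimates carry the positive factor \<open>lam_bar\<close>, which is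
      cancelled only now.\<close>
    finally have "lam_bar * (?lam * (W + V)) \<le> lam_bar * (A + C)"
      by (simp add: algebra_simps)
    then have "?lam * (W + V) \<le> A + C"
      using assms(7) by (simp only: mult_le_cancel_left_pos)
    then show "?lam * var_on \<Omega> \<pi> f \<le> dirichlet_on \<Omega> P \<pi> f"
      unfolding var_decomposition dirichlet_decomposition W_def V_def A_def C_def .
  qed
qed

end
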